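(* Let $\varphi,\psi\colon K\to L$ be simplicial maps and let $\alpha\colon L\to M$ be a simplicial map with a left strong homotopy type inverse, i.e. there is a simplicial map $\beta\colon M\to L$ with $\beta\circ\alpha\sim\mathrm{id}_L$. Then $\mathrm{SimpD}(\alpha\circ\varphi,\alpha\circ\psi)=\mathrm{SimpD}(\varphi,\psi)$.
   Context: $K,L,M$ are (ordered) simplicial complexes: abstract simplicial complexes with a partial order on the vertices restricting to a total order on each simplex. A simplicial map is a map of vertices sending simplices to simplices. Contiguity: simplicial maps $\varphi,\psi\colon K\to L$ are contiguous if for every simplex $\sigma$ of $K$, $\varphi(\sigma)\cup\psi(\sigma)$ is a simplex of $L$. For $c\in\mathbb{Z}_{\ge0}$, they are $c$-contiguous ($\varphi\sim_c\psi$) if there are simplicial maps $H_0,\dots,H_c\colon K\to L$ with $H_0=\varphi$, $H_c=\psi$ and each pair $(H_{i-1},H_i)$ contiguous, $1\le i\le c$. We write $\varphi\sim\psi$ (same contiguity class) if $\varphi\sim_c\psi$ for some $c\ge 0$. Subdivisions: $\mathrm{Sd}^b(K)$ is the $b$-th iterated barycentric subdivision ($\mathrm{Sd}^0(K)=K$). For each $b\ge 0$ a simplicial approximation $\iota\colon\mathrm{Sd}^{b+1}(K)\to\mathrm{Sd}^b(K)$ of the identity of the realization $\|K\|$ is fixed (i.e. a simplicial map sending each vertex of $\mathrm{Sd}^{b+1}(K)$, regarded as a simplex $\sigma$ of $\mathrm{Sd}^b(K)$, to a vertex of $\sigma$); composites of these are also denoted $\iota\colon \mathrm{Sd}^b(K)\to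 K$. Simplicial distance: for simplicial maps $\varphi,\psi\colon K\to L$ and $b,c\in\mathbb{Z}_{\ge0}$, $\mathrm{SimpD}^b_c(\varphi,\psi)$ is the least integer $k\ge0$ such that there are subcomplexes $J_0,\dots,J_k$ covering $\mathrm{Sd}^b(K)$ for which the composites $J_i\hookrightarrow\mathrm{Sd}^b(K)\xrightarrow{\iota}K\xrightarrow{\varphi}L$ and $J_i\hookrightarrow\mathrm{Sd}^b(K)\xrightarrow{\iota}K\xrightarrow{\psi}L$ are $c$-contiguous for each $i$; it is $\infty$ if no such $k$ exists. It is non-increasing in $c$; $\mathrm{SimpD}^b(\varphi,\psi)$ denotes its stable value as $c\to\infty$. The sequence $\mathrm{SimpD}^b(\varphi,\psi)$ is non-increasing in $b$; $\mathrm{SimpD}(\varphi,\psi)$ denotes its stable value as $b\to\infty$. *)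

theory Defs
  imports Main "HOL-Library.Extended_Nat" "HOL-Library.FSet"
begin

definition simplicial_complex :: "'a set set \<Rightarrow> bool" where
  "simplicial_complex K \<longleftrightarrow>
     (\<forall>\<sigma>\<in>K. finite \<sigma> \<and> \<sigma> \<noteq> {}) \<and> (\<forall>\<sigma>\<in>K. \<forall>\<tau>. \<tau> \<subseteq> \<sigma> \<and> \<tau> \<noteq> {} \<longrightarrow> \<tau> \<in> K)"

abbreviation vertices :: "'a set set \<Rightarrow> 'a set" where
  "vertices K \<equiv> \<Union>K"

definition ordered_simplicial_complex :: "'a set set \<Rightarrow> 'a rel \<Rightarrow> bool" where
  "ordered_simplicial_complex K r \<longleftrightarrow>
     simplicial_complex K \<and> partial_order_on (vertices K) r \<and> (\<forall>\<sigma>\<in>K. total_on \<sigma> r)"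

text \<open>The empty complex counts as a subcomplex.\<close>

definition subcomplex :: "'a set set \<Rightarrow> 'a set set \<Rightarrow> bool" where
  "subcomplex J K \<longleftrightarrow> simplicial_complex J \<and> J \<subseteq> K"

definition simplicial_map :: "'a set set \<Rightarrow> 'b set set \<Rightarrow> ('a \<Rightarrow> 'b) \<Rightarrow> bool" where
  "simplicial_map K L \<phi> \<longleftrightarrow> (\<forall>\<sigma>\<in>K. \<phi> ` \<sigma> \<in> L)"

definition contiguous :: "'a set set \<Rightarrow> 'b set set \<Rightarrow> ('a \<Rightarrow> 'b) \<Rightarrow> ('a \<Rightarrow> 'b) \<Rightarrow> bool" where
  "contiguous K L \<phi> \<psi> \<longleftrightarrow>
     simplicial_map K L \<phi> \<and> simplicial_map K L \<psi> \<and> (\<forall>\<sigma>\<in>K. \<phi> ` \<sigma> \<union> \<psi> ` \<sigma> \<in> L)"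

text \<open>
  A simplicial map is represented by a total function whose values off the vertex set are
  irrelevant, so the endpoint conditions are equalities on vertices.
\<close>

definition c_contiguous ::
  "nat \<Rightarrow> 'a set set \<Rightarrow> 'b set set \<Rightarrow> ('a \<Rightarrow> 'b) \<Rightarrow> ('a \<Rightarrow> 'b) \<Rightarrow> bool" where
  "c_contiguous c K L \<phi> \<psi> \<longleftrightarrow>
     (\<exists>H :: nat \<Rightarrow> 'a \<Rightarrow> 'b.
        (\<forall>i\<le>c. simplicial_map K L (H i)) \<and>
        (\<forall>v\<in>vertices K. H 0 v = \<phi> v) \<and>
        (\<forall>v\<in>vertices K. H c v = \<psi> v) \<and>
        (\<forall>i. 1 \<le> i \<and> i \<le> c \<longrightarrow> contiguous K L (H (i - 1)) (H i)))"

definition same_contiguity_class ::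
  "'a set set \<Rightarrow> 'b set set \<Rightarrow> ('a \<Rightarrow> 'b) \<Rightarrow> ('a \<Rightarrow> 'b) \<Rightarrow> bool" where
  "same_contiguity_class K L \<phi> \<psi> \<longleftrightarrow> (\<exists>c. c_contiguous c K L \<phi> \<psi>)"

text \<open>
  All iterated subdivisions of a complex on \<open>'a\<close> live on the single type \<open>'a sdv\<close>:
  \<open>Orig v\<close> is a vertex of the original complex, \<open>Bary S\<close> is the barycentre of the
  simplex \<open>S\<close> of the preceding subdivision. Thus the 0-th subdivision is the copy of
  \<open>K\<close> obtained by renaming each vertex \<open>v\<close> to \<open>Orig v\<close>.
\<close>

datatype 'a sdv = Orig (the_Orig: 'a) | Bary "'a sdv fset"

definition Sd :: "'a sdv set set \<Rightarrow> 'a sdv set set" where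
  "Sd K = {Bary ` {S. fset S \<in> C} | C.
             C \<subseteq> K \<and> finite C \<and> C \<noteq> {} \<and> (\<forall>\<sigma>\<in>C. \<forall>\<tau>\<in>C. \<sigma> \<subseteq> \<tau> \<or> \<tau> \<subseteq> \<sigma>)}"

primrec Sd_iter :: "nat \<Rightarrow> 'a set set \<Rightarrow> 'a sdv set set" where
  "Sd_iter 0 K = (\<lambda>\<sigma>. Orig ` \<sigma>) ` K"
| "Sd_iter (Suc b) K = Sd (Sd_iter b K)"

text \<open>\<open>\<iota> b\<close> is the chosen approximation from the \<open>(b+1)\<close>-st to the \<open>b\<close>-th subdivision.\<close>

definition identity_approximations ::
  "'a set set \<Rightarrow> (nat \<Rightarrow> 'a sdv \<Rightarrow> 'a sdv) \<Rightarrow> bool" where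
  "identity_approximations K \<iota> \<longleftrightarrow>
     (\<forall>b. simplicial_map (Sd_iter (Suc b) K) (Sd_iter b K) (\<iota> b) \<and>
          (\<forall>S. fset S \<in> Sd_iter b K \<longrightarrow> \<iota> b (Bary S) \<in> fset S))"

primrec iota_comp :: "(nat \<Rightarrow> 'a sdv \<Rightarrow> 'a sdv) \<Rightarrow> nat \<Rightarrow> 'a sdv \<Rightarrow> 'a" where
  "iota_comp \<iota> 0 = the_Orig"
| "iota_comp \<iota> (Suc b) = iota_comp \<iota> b \<circ> \<iota> b"

text \<open>\<open>Inf\<close> on \<open>enat\<close> is the least element, and \<open>\<infinity>\<close> for the empty set.\<close>

definition SimpD_bc ::
  "'a set set \<Rightarrow> 'b set set \<Rightarrow> (nat \<Rightarrow> 'a sdv \<Rightarrow> 'a sdv) \<Rightarrow> nat \<Rightarrow> nat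
     \<Rightarrow> ('a \<Rightarrow> 'b) \<Rightarrow> ('a \<Rightarrow> 'b) \<Rightarrow> enat" where
  "SimpD_bc K L \<iota> b c \<phi> \<psi> =
     Inf {enat k | k. \<exists>J :: nat \<Rightarrow> 'a sdv set set.
            (\<forall>i\<le>k. subcomplex (J i) (Sd_iter b K)) \<and>
            (\<Union>i\<le>k. J i) = Sd_iter b K \<and>
            (\<forall>i\<le>k. c_contiguous c (J i) L (\<phi> \<circ> iota_comp \<iota> b) (\<psi> \<circ> iota_comp \<iota> b))}"

text \<open>Meaningful only for eventually constant sequences; see the lemmas below.\<close>

definition stable_value :: "(nat \<Rightarrow> enat) \<Rightarrow> enat" where
  "stable_value s = (THE d. \<forall>\<^sub>F n in sequentially. s n = d)"

definition SimpD_b ::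
  "'a set set \<Rightarrow> 'b set set \<Rightarrow> (nat \<Rightarrow> 'a sdv \<Rightarrow> 'a sdv) \<Rightarrow> nat
     \<Rightarrow> ('a \<Rightarrow> 'b) \<Rightarrow> ('a \<Rightarrow> 'b) \<Rightarrow> enat" where
  "SimpD_b K L \<iota> b \<phi> \<psi> = stable_value (\<lambda>c. SimpD_bc K L \<iota> b c \<phi> \<psi>)"

definition SimpD ::
  "'a set set \<Rightarrow> 'b set set \<Rightarrow> (nat \<Rightarrow> 'a sdv \<Rightarrow> 'a sdv)
     \<Rightarrow> ('a \<Rightarrow> 'b) \<Rightarrow> ('a \<Rightarrow> 'b) \<Rightarrow> enat" where
  "SimpD K L \<iota> \<phi> \<psi> = stable_value (\<lambda>b. SimpD_b K L \<iota> b \<phi> \<psi>)"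

lemma antimono_enat_eventually_Inf:
  fixes s :: "nat \<Rightarrow> enat"
  assumes "antimono s"
  shows "\<forall>\<^sub>F n in sequentially. s n = Inf (range s)"
proof -
  have "Inf (range s) \<in> range s"
    by (metis (mono_tags, lifting) Inf_enat_def LeastI empty_iff rangeI)
  then obtain N where N: "s N = Inf (range s)" by auto
  have "s n = Inf (range s)" if "N \<le> n" for n
    by (metis N antisym Inf_lower rangeI antimonoD[OF assms that])
  then show ?thesis unfolding eventually_sequentially by blast
qed

lemma stable_value_antimono:
  assumes "antimono s"
  shows "\<forall>\<^sub>F n in sequentially. s n = stable_value s" "stable_value s = Inf (range s)"
proof -
  note E = antimono_enat_eventually_Inf[OF assms]
  show *: "stable_value s = Inf (range s)"
    unfolding stable_value_def
  proof (rule the_equality)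
    show "\<forall>\<^sub>F n in sequentially. s n = Inf (range s)" by (rule E)
    fix d assume "\<forall>\<^sub>F n in sequentially. s n = d"
    with E have "\<forall>\<^sub>F n in sequentially. d = Inf (range s)"
      by eventually_elim simp
    then show "d = Inf (range s)" by simp
  qed
  show "\<forall>\<^sub>F n in sequentially. s n = stable_value s"
    using E by (simp add: *)
qed

lemma c_contiguous_Suc:
  assumes "simplicial_complex L" "c_contiguous c K L \<phi> \<psi>"
  shows "c_contiguous (Suc c) K L \<phi> \<psi>"
proof -
  obtain H where H: "\<forall>i\<le>c. simplicial_map K L (H i)" "\<forall>v\<in>vertices K. H 0 v = \<phi> v"
    "\<forall>v\<in>vertices K. H c v = \<psi> v"
    "\<forall>i. 1 \<le> i \<and> i \<le> c \<longrightarrow> contiguous K L (H (i - 1)) (H i)"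
    using assms(2) unfolding c_contiguous_def by blast
  define G where "G i = H (min i c)" for i
  have "contiguous K L (G (i - 1)) (G i)" if "1 \<le> i" "i \<le> Suc c" for i
  proof (cases "i \<le> c")
    case True
    then have "G (i - 1) = H (i - 1)" "G i = H i" by (simp_all add: G_def)
    then show ?thesis using H(4) that True by simp
  next
    case False
    then have "i = Suc c" using that by simp
    then show ?thesis
      using H(1) by (auto simp: G_def contiguous_def simplicial_map_def)
  qed
  then have "\<exists>G. (\<forall>i\<le>Suc c. simplicial_map K L (G i)) \<and> (\<forall>v\<in>vertices K. G 0 v = \<phi> v) \<and>
     (\<forall>v\<in>vertices K. G (Suc c) v = \<psi> v) \<and>
     (\<forall>i. 1 \<le> i \<and> i \<le> Suc c \<longrightarrow> contiguous K L (G (i - 1)) (G i))"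
    using H(1-3) by (intro exI[of _ G]) (auto simp: G_def)
  then show ?thesis unfolding c_contiguous_def .
qed

lemma antimono_SimpD_bc:
  assumes "simplicial_complex L"
  shows "antimono (\<lambda>c. SimpD_bc K L \<iota> b c \<phi> \<psi>)"
  unfolding decseq_Suc_iff SimpD_bc_def
proof (intro allI Inf_superset_mono Collect_mono impI)
  fix c and x :: enat
  assume "\<exists>k. x = enat k \<and> (\<exists>J. (\<forall>i\<le>k. subcomplex (J i) (Sd_iter b K)) \<and>
      (\<Union>i\<le>k. J i) = Sd_iter b K \<and>
      (\<forall>i\<le>k. c_contiguous c (J i) L (\<phi> \<circ> iota_comp \<iota> b) (\<psi> \<circ> iota_comp \<iota> b)))"
  then obtain k J where *: "x = enat k" "\<forall>i\<le>k. subcomplex (J i) (Sd_iter b K)"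
      "(\<Union>i\<le>k. J i) = Sd_iter b K"
      "\<forall>i\<le>k. c_contiguous c (J i) L (\<phi> \<circ> iota_comp \<iota> b) (\<psi> \<circ> iota_comp \<iota> b)"
    by (elim exE conjE)
  show "\<exists>k. x = enat k \<and> (\<exists>J. (\<forall>i\<le>k. subcomplex (J i) (Sd_iter b K)) \<and>
      (\<Union>i\<le>k. J i) = Sd_iter b K \<and>
      (\<forall>i\<le>k. c_contiguous (Suc c) (J i) L (\<phi> \<circ> iota_comp \<iota> b) (\<psi> \<circ> iota_comp \<iota> b)))"
    by (intro exI[of _ k] exI[of _ J] conjI *(1-3) allI impI c_contiguous_Suc[OF assms])
      (rule *(4)[rule_format])
qed

lemma c_contiguous_precomp:
  assumes "c_contiguous c J L \<phi> \<psi>" "simplicial_map J' J f"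
  shows "c_contiguous c J' L (\<phi> \<circ> f) (\<psi> \<circ> f)"
proof -
  obtain H where H: "\<forall>i\<le>c. simplicial_map J L (H i)" "\<forall>v\<in>vertices J. H 0 v = \<phi> v"
    "\<forall>v\<in>vertices J. H c v = \<psi> v"
    "\<forall>i. 1 \<le> i \<and> i \<le> c \<longrightarrow> contiguous J L (H (i - 1)) (H i)"
    using assms(1) unfolding c_contiguous_def by blast
  have v: "f v \<in> vertices J" if "v \<in> vertices J'" for v
    using assms(2) that unfolding simplicial_map_def by blast
  have im: "(H i \<circ> f) ` \<sigma> = H i ` (f ` \<sigma>)" for i \<sigma> by (simp add: image_comp)
  have f: "f ` \<sigma> \<in> J" if "\<sigma> \<in> J'" for \<sigma>
    using assms(2) that unfolding simplicial_map_def by blast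
  show ?thesis
    unfolding c_contiguous_def
  proof (intro exI[of _ "\<lambda>i. H i \<circ> f"] conjI allI impI ballI)
    show "simplicial_map J' L (H i \<circ> f)" if "i \<le> c" for i
      using H(1) that f unfolding simplicial_map_def im by blast
    show "contiguous J' L (H (i - 1) \<circ> f) (H i \<circ> f)" if "1 \<le> i \<and> i \<le> c" for i
      using H(4) that f unfolding contiguous_def simplicial_map_def im by blast
  qed (simp_all only: comp_apply H(2,3)[rule_format] v)
qed

lemma simplicial_complex_Sd:
  assumes "simplicial_complex K"
  shows "simplicial_complex (Sd K)"
proof -
  have fin: "finite \<sigma>" if "\<sigma> \<in> K" for \<sigma>
    using assms that by (auto simp: simplicial_complex_def)
  have 1: "finite \<rho> \<and> \<rho> \<noteq> {}" if "\<rho> \<in> Sd K" for \<rho>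
  proof -
    obtain C where C: "\<rho> = Bary ` {S. fset S \<in> C}" "C \<subseteq> K" "finite C" "C \<noteq> {}"
      using \<open>\<rho> \<in> Sd K\<close> unfolding Sd_def by blast
    have "finite {S. fset S \<in> C}"
      using finite_vimageI[OF C(3), of fset] by (simp add: fset_inject inj_on_def vimage_def)
    moreover obtain \<sigma> where "\<sigma> \<in> C" using C(4) by blast
    then have "fset (Abs_fset \<sigma>) \<in> C"
      using C(2) fin by (metis Abs_fset_inverse mem_Collect_eq subsetD)
    ultimately show ?thesis using C(1) by auto
  qed
  have 2: "\<tau> \<in> Sd K" if \<rho>: "\<rho> \<in> Sd K" and "\<tau> \<subseteq> \<rho>" "\<tau> \<noteq> {}" for \<rho> \<tau>
  proof -
    obtain C where C: "\<rho> = Bary ` {S. fset S \<in> C}" "C \<subseteq> K" "finite C"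
      "\<forall>\<sigma>\<in>C. \<forall>\<tau>\<in>C. \<sigma> \<subseteq> \<tau> \<or> \<tau> \<subseteq> \<sigma>"
      using \<rho> unfolding Sd_def by blast
    define D where "D = fset ` {S. Bary S \<in> \<tau>}"
    have D: "D \<subseteq> C" using \<open>\<tau> \<subseteq> \<rho>\<close> C(1) by (auto simp: D_def)
    have eq: "\<tau> = Bary ` {S. fset S \<in> D}"
    proof (rule set_eqI)
      fix x
      have "x \<in> \<tau> \<longleftrightarrow> (\<exists>S. x = Bary S \<and> Bary S \<in> \<tau>)"
        using \<open>\<tau> \<subseteq> \<rho>\<close> C(1) by blast
      also have "\<dots> \<longleftrightarrow> x \<in> Bary ` {S. fset S \<in> D}"
        by (auto simp: D_def image_iff fset_inject)
      finally show "x \<in> \<tau> \<longleftrightarrow> x \<in> Bary ` {S. fset S \<in> D}" .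
    qed
    have "D \<noteq> {}" using eq \<open>\<tau> \<noteq> {}\<close> by auto
    moreover have "D \<subseteq> K" "finite D" using D C(2,3) by (auto intro: finite_subset)
    moreover have "\<forall>\<sigma>\<in>D. \<forall>\<tau>\<in>D. \<sigma> \<subseteq> \<tau> \<or> \<tau> \<subseteq> \<sigma>" using D C(4) by blast
    ultimately show ?thesis
      unfolding Sd_def by (intro CollectI exI[of _ D] conjI eq)
  qed
  show ?thesis unfolding simplicial_complex_def using 1 2 by blast
qed

lemma simplicial_complex_Sd_iter:
  assumes "simplicial_complex K"
  shows "simplicial_complex (Sd_iter b K)"
proof (induction b)
  case 0
  show ?case
    unfolding simplicial_complex_def
  proof (intro conjI ballI allI impI)
    fix \<sigma> \<tau> assume "\<sigma> \<in> Sd_iter 0 K" and \<tau>: "\<tau> \<subseteq> \<sigma> \<and> \<tau> \<noteq> {}"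
    then obtain \<rho> where \<rho>: "\<rho> \<in> K" "\<sigma> = Orig ` \<rho>" by auto
    with \<tau> obtain \<rho>' where \<rho>': "\<rho>' \<subseteq> \<rho>" "\<tau> = Orig ` \<rho>'" by (metis subset_image_iff)
    with \<tau> \<rho>(1) assms have "\<rho>' \<in> K" unfolding simplicial_complex_def by blast
    with \<rho>' show "\<tau> \<in> Sd_iter 0 K" by simp
  qed (use assms in \<open>auto simp: simplicial_complex_def\<close>)
next
  case (Suc b)
  then show ?case by (simp add: simplicial_complex_Sd)
qed

lemma SimpD_bc_Suc_le:
  assumes K: "simplicial_complex K" and a: "identity_approximations K \<iota>"
  shows "SimpD_bc K L \<iota> (Suc b) c \<phi> \<psi> \<le> SimpD_bc K L \<iota> b c \<phi> \<psi>"
  unfolding SimpD_bc_def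
proof (rule Inf_superset_mono, clarify)
  fix k :: nat and J :: "nat \<Rightarrow> 'a sdv set set"
  assume J: "\<forall>i\<le>k. subcomplex (J i) (Sd_iter b K)" "(\<Union>i\<le>k. J i) = Sd_iter b K"
    "\<forall>i\<le>k. c_contiguous c (J i) L (\<phi> \<circ> iota_comp \<iota> b) (\<psi> \<circ> iota_comp \<iota> b)"
  define J' where "J' i = {\<sigma> \<in> Sd_iter (Suc b) K. \<iota> b ` \<sigma> \<in> J i}" for i
  have s: "simplicial_map (Sd_iter (Suc b) K) (Sd_iter b K) (\<iota> b)"
    using a unfolding identity_approximations_def by blast
  have "subcomplex (J' i) (Sd_iter (Suc b) K)" if "i \<le> k" for i
    unfolding subcomplex_def simplicial_complex_def
  proof (intro conjI ballI allI impI)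
    note S = simplicial_complex_Sd_iter[OF K, of "Suc b", unfolded simplicial_complex_def]
    show "J' i \<subseteq> Sd_iter (Suc b) K" unfolding J'_def by blast
    show "finite \<sigma>" "\<sigma> \<noteq> {}" if "\<sigma> \<in> J' i" for \<sigma>
      using that S unfolding J'_def by blast+
    fix \<sigma> \<tau> assume \<sigma>: "\<sigma> \<in> J' i" and \<tau>: "\<tau> \<subseteq> \<sigma> \<and> \<tau> \<noteq> {}"
    then have "\<tau> \<in> Sd_iter (Suc b) K" using S unfolding J'_def by blast
    moreover have "\<iota> b ` \<tau> \<subseteq> \<iota> b ` \<sigma>" "\<iota> b ` \<tau> \<noteq> {}" "\<iota> b ` \<sigma> \<in> J i"
      using \<sigma> \<tau> unfolding J'_def by (blast, simp, blast)
    then have "\<iota> b ` \<tau> \<in> J i"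
      using J(1) \<open>i \<le> k\<close> unfolding subcomplex_def simplicial_complex_def by meson
    ultimately show "\<tau> \<in> J' i" unfolding J'_def by blast
  qed
  moreover have "(\<Union>i\<le>k. J' i) = Sd_iter (Suc b) K"
  proof
    show "(\<Union>i\<le>k. J' i) \<subseteq> Sd_iter (Suc b) K" unfolding J'_def by blast
    show "Sd_iter (Suc b) K \<subseteq> (\<Union>i\<le>k. J' i)"
    proof
      fix \<sigma> assume \<sigma>: "\<sigma> \<in> Sd_iter (Suc b) K"
      with s have "\<iota> b ` \<sigma> \<in> (\<Union>i\<le>k. J i)" unfolding J(2) simplicial_map_def by blast
      with \<sigma> show "\<sigma> \<in> (\<Union>i\<le>k. J' i)" unfolding J'_def by blast
    qed
  qed
  moreover have "c_contiguous c (J' i) L (\<phi> \<circ> iota_comp \<iota> (Suc b)) (\<psi> \<circ> iota_comp \<iota> (Suc b))"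
    if "i \<le> k" for i
  proof -
    have "simplicial_map (J' i) (J i) (\<iota> b)"
      by (auto simp: J'_def simplicial_map_def)
    from c_contiguous_precomp[OF J(3)[rule_format, OF that] this]
    show ?thesis by (simp only: iota_comp.simps comp_assoc)
  qed
  ultimately show "\<exists>k'. enat k = enat k' \<and> (\<exists>J. (\<forall>i\<le>k'. subcomplex (J i) (Sd_iter (Suc b) K)) \<and>
      (\<Union>i\<le>k'. J i) = Sd_iter (Suc b) K \<and>
      (\<forall>i\<le>k'. c_contiguous c (J i) L (\<phi> \<circ> iota_comp \<iota> (Suc b)) (\<psi> \<circ> iota_comp \<iota> (Suc b))))"
    by (intro exI[of _ k] exI[of _ J'] conjI refl allI impI)
qed

lemma antimono_SimpD_b:
  assumes "simplicial_complex K" "simplicial_complex L" "identity_approximations K \<iota>"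
  shows "antimono (\<lambda>b. SimpD_b K L \<iota> b \<phi> \<psi>)"
  unfolding decseq_Suc_iff SimpD_b_def stable_value_antimono(2)[OF antimono_SimpD_bc[OF assms(2)]]
  by (intro allI INF_mono') (rule SimpD_bc_Suc_le[OF assms(1,3)])

end

theory Submission
  imports Defs
begin

text \<open>
  Postcomposing with \<open>\<alpha>\<close> turns a cover for \<open>\<phi>, \<psi>\<close> into one for \<open>\<alpha> \<circ> \<phi>, \<alpha> \<circ> \<psi>\<close>. Conversely, if
  \<open>\<beta> \<circ> \<alpha>\<close> is \<open>d\<close>-contiguous to the identity and \<open>\<alpha> \<circ> \<phi>, \<alpha> \<circ> \<psi>\<close> are \<open>c\<close>-contiguous on a subcomplex,
  then \<open>\<phi> \<sim> \<beta> \<circ> \<alpha> \<circ> \<phi> \<sim> \<beta> \<circ> \<alpha> \<circ> \<psi> \<sim> \<psi>\<close> in \<open>d + c + d\<close> steps there. Hence the same covers work,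
  up to a shift in \<open>c\<close> which does not affect the stable value.
\<close>

text \<open>Contiguity only looks at images of simplices, hence only at values on vertices. This
  lets two total functions representing the same simplicial map be exchanged.\<close>

lemma contiguous_cong:
  assumes "\<And>v. v \<in> vertices K \<Longrightarrow> \<phi> v = \<phi>' v" "\<And>v. v \<in> vertices K \<Longrightarrow> \<psi> v = \<psi>' v"
  shows "contiguous K L \<phi> \<psi> \<longleftrightarrow> contiguous K L \<phi>' \<psi>'"
proof -
  have "\<phi> ` \<sigma> = \<phi>' ` \<sigma>" "\<psi> ` \<sigma> = \<psi>' ` \<sigma>" if "\<sigma> \<in> K" for \<sigma>
    using that assms by (auto intro!: image_cong)
  then show ?thesis by (simp add: contiguous_def simplicial_map_def)
qed

lemma contiguous_sym: "contiguous K L \<phi> \<psi> \<Longrightarrow> contiguous K L \<psi> \<phi>"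
  by (auto simp: contiguous_def Un_commute)

lemma simplicial_map_comp:
  "simplicial_map K L f \<Longrightarrow> simplicial_map L M g \<Longrightarrow> simplicial_map K M (g \<circ> f)"
  unfolding simplicial_map_def image_comp[symmetric] by blast

text \<open>This rule and the next reindex the contiguous pairs of a chain by \<open>i < c\<close>,
  so that later proofs avoid the truncated \<open>i - 1\<close>.\<close>

lemma c_contiguousE:
  assumes "c_contiguous c K L \<phi> \<psi>"
  obtains H where "\<And>i. i \<le> c \<Longrightarrow> simplicial_map K L (H i)"
    "\<And>v. v \<in> vertices K \<Longrightarrow> H 0 v = \<phi> v" "\<And>v. v \<in> vertices K \<Longrightarrow> H c v = \<psi> v"
    "\<And>i. i < c \<Longrightarrow> contiguous K L (H i) (H (Suc i))"
proof -
  obtain H where H: "\<forall>i\<le>c. simplicial_map K L (H i)" "\<forall>v\<in>vertices K. H 0 v = \<phi> v"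
    "\<forall>v\<in>vertices K. H c v = \<psi> v"
    "\<forall>i. 1 \<le> i \<and> i \<le> c \<longrightarrow> contiguous K L (H (i - 1)) (H i)"
    using assms unfolding c_contiguous_def by blast
  have "contiguous K L (H i) (H (Suc i))" if "i < c" for i
    using H(4)[rule_format, of "Suc i"] that by simp
  with H(1-3) show ?thesis by (intro that[of H]) blast+
qed

lemma c_contiguousI:
  assumes "\<And>i. i \<le> c \<Longrightarrow> simplicial_map K L (H i)"
    "\<And>v. v \<in> vertices K \<Longrightarrow> H 0 v = \<phi> v" "\<And>v. v \<in> vertices K \<Longrightarrow> H c v = \<psi> v"
    "\<And>i. i < c \<Longrightarrow> contiguous K L (H i) (H (Suc i))"
  shows "c_contiguous c K L \<phi> \<psi>"
  unfolding c_contiguous_def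
proof (intro exI[of _ H] conjI allI impI ballI)
  fix i assume "1 \<le> i \<and> i \<le> c"
  then show "contiguous K L (H (i - 1)) (H i)" using assms(4)[of "i - 1"] by (cases i) simp_all
qed (use assms(1-3) in blast)+

lemma c_contiguous_sym:
  assumes "c_contiguous c K L \<phi> \<psi>"
  shows "c_contiguous c K L \<psi> \<phi>"
proof -
  obtain H where H: "\<And>i. i \<le> c \<Longrightarrow> simplicial_map K L (H i)"
    "\<And>v. v \<in> vertices K \<Longrightarrow> H 0 v = \<phi> v" "\<And>v. v \<in> vertices K \<Longrightarrow> H c v = \<psi> v"
    "\<And>i. i < c \<Longrightarrow> contiguous K L (H i) (H (Suc i))"
    using c_contiguousE[OF assms] by blast
  show ?thesis
  proof (rule c_contiguousI[where H = "\<lambda>i. H (c - i)"])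
    fix i assume "i < c"
    then show "contiguous K L (H (c - i)) (H (c - Suc i))"
      \<comment> \<open>The pair at \<open>c - Suc i\<close> of the old chain, read
        backwards.\<close>
      using H(4)[of "c - Suc i"] by (simp add: contiguous_sym Suc_diff_Suc)
  qed (simp_all add: H)
qed

lemma c_contiguous_trans:
  assumes "c_contiguous c K L \<phi> \<chi>" "c_contiguous d K L \<chi> \<psi>"
  shows "c_contiguous (c + d) K L \<phi> \<psi>"
proof -
  obtain G where G: "\<And>i. i \<le> c \<Longrightarrow> simplicial_map K L (G i)"
    "\<And>v. v \<in> vertices K \<Longrightarrow> G 0 v = \<phi> v" "\<And>v. v \<in> vertices K \<Longrightarrow> G c v = \<chi> v"
    "\<And>i. i < c \<Longrightarrow> contiguous K L (G i) (G (Suc i))"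
    using c_contiguousE[OF assms(1)] by blast
  obtain H where H: "\<And>i. i \<le> d \<Longrightarrow> simplicial_map K L (H i)"
    "\<And>v. v \<in> vertices K \<Longrightarrow> H 0 v = \<chi> v" "\<And>v. v \<in> vertices K \<Longrightarrow> H d v = \<psi> v"
    "\<And>i. i < d \<Longrightarrow> contiguous K L (H i) (H (Suc i))"
    using c_contiguousE[OF assms(2)] by blast
  define F where "F i = (if i \<le> c then G i else H (i - c))" for i
  \<comment> \<open>At the junction \<open>i = c\<close> the functions \<open>G c\<close> and
    \<open>H 0\<close> both represent \<chi>, but they need to agree on vertices only. Hence
    equality is claimed pointwise, and contiguity past the junction is transferred by
    \<open>contiguous_cong\<close>.\<close>
  have F_H: "F i v = H (i - c) v" if "c \<le> i" "v \<in> vertices K" for i v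
    using that G(3) H(2) by (cases "i = c") (auto simp: F_def simp del: Union_iff)
  show ?thesis
  proof (rule c_contiguousI[where H = F])
    fix i assume i: "i < c + d"
    show "contiguous K L (F i) (F (Suc i))"
    proof (cases "i < c")
      case True
      then show ?thesis using G(4) by (simp add: F_def)
    next
      case False
      then have "contiguous K L (H (i - c)) (H (Suc i - c))"
        using i H(4)[of "i - c"] by (simp add: Suc_diff_le)
      moreover have "contiguous K L (F i) (F (Suc i)) \<longleftrightarrow>
          contiguous K L (H (i - c)) (H (Suc i - c))"
        by (rule contiguous_cong; rule F_H) (use False in simp_all)
      ultimately show ?thesis by simp
    qed
  next
    show "F (c + d) v = \<psi> v" if "v \<in> vertices K" for v
      using F_H[of "c + d" v] H(3) that by simp
  qed (use G H in \<open>auto simp: F_def simp del: Union_iff\<close>)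
qed

lemma c_contiguous_postcomp:
  assumes "c_contiguous c K L \<phi> \<psi>" "simplicial_map L M f"
  shows "c_contiguous c K M (f \<circ> \<phi>) (f \<circ> \<psi>)"
proof -
  obtain H where H: "\<And>i. i \<le> c \<Longrightarrow> simplicial_map K L (H i)"
    "\<And>v. v \<in> vertices K \<Longrightarrow> H 0 v = \<phi> v" "\<And>v. v \<in> vertices K \<Longrightarrow> H c v = \<psi> v"
    "\<And>i. i < c \<Longrightarrow> contiguous K L (H i) (H (Suc i))"
    using c_contiguousE[OF assms(1)] by blast
  show ?thesis
  proof (rule c_contiguousI[where H = "\<lambda>i. f \<circ> H i"])
    fix i assume "i < c"
    from H(4)[OF this] assms(2) show "contiguous K M (f \<circ> H i) (f \<circ> H (Suc i))"
      unfolding contiguous_def simplicial_map_def image_comp[symmetric] image_Un[symmetric] by blast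
  qed (simp_all add: H simplicial_map_comp[OF _ assms(2)] del: Union_iff)
qed

lemma c_contiguous_cancel_left_inverse:
  assumes "c_contiguous c J M (\<alpha> \<circ> f) (\<alpha> \<circ> g)"
    and "c_contiguous d L L (\<beta> \<circ> \<alpha>) id" "simplicial_map M L \<beta>"
    and "simplicial_map J L f" "simplicial_map J L g"
  shows "c_contiguous (d + c + d) J L f g"
proof -
  \<comment> \<open>The chain from \<open>\<beta> \<circ> \<alpha>\<close> to \<open>id\<close> is
    precomposed with \<open>f\<close> and with \<open>g\<close>; this is where their simpliciality
    on \<open>J\<close> enters.\<close>
  have "c_contiguous d J L (\<beta> \<circ> \<alpha> \<circ> f) f" "c_contiguous d J L (\<beta> \<circ> \<alpha> \<circ> g) g"
    using c_contiguous_precomp[OF assms(2,4)] c_contiguous_precomp[OF assms(2,5)] by simp_all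
  moreover have "c_contiguous c J L (\<beta> \<circ> \<alpha> \<circ> f) (\<beta> \<circ> \<alpha> \<circ> g)"
    using c_contiguous_postcomp[OF assms(1,3)] by (simp add: comp_assoc)
  ultimately show ?thesis
    by (meson c_contiguous_sym c_contiguous_trans)
qed

lemma simplicial_map_iota_comp:
  assumes "identity_approximations K \<iota>"
  shows "simplicial_map (Sd_iter b K) K (iota_comp \<iota> b)"
proof (induction b)
  case 0
  \<comment> \<open>\<open>the_Orig\<close> undoes the renaming of vertices in the 0-th
    subdivision.\<close>
  then show ?case by (auto simp: simplicial_map_def image_comp)
next
  case (Suc b)
  have "simplicial_map (Sd_iter (Suc b) K) (Sd_iter b K) (\<iota> b)"
    using assms unfolding identity_approximations_def by blast
  from simplicial_map_comp[OF this Suc] show ?case by (simp only: iota_comp.simps)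
qed

text \<open>Under the assumption every cover admissible for \<phi>, \<psi> is admissible for
  \<phi>', \<psi>' with the same \<open>k\<close>, so the infimum on the left is taken over a larger
  set.\<close>

lemma SimpD_bc_mono:
  assumes "\<And>J. subcomplex J (Sd_iter b K) \<Longrightarrow>
      c_contiguous c J L (\<phi> \<circ> iota_comp \<iota> b) (\<psi> \<circ> iota_comp \<iota> b) \<Longrightarrow>
      c_contiguous c' J L' (\<phi>' \<circ> iota_comp \<iota> b) (\<psi>' \<circ> iota_comp \<iota> b)"
  shows "SimpD_bc K L' \<iota> b c' \<phi>' \<psi>' \<le> SimpD_bc K L \<iota> b c \<phi> \<psi>"
  unfolding SimpD_bc_def
proof (rule Inf_superset_mono, clarify)
  fix k :: nat and J
  assume "\<forall>i\<le>k. subcomplex (J i) (Sd_iter b K)" "(\<Union>i\<le>k. J i) = Sd_iter b K"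
    "\<forall>i\<le>k. c_contiguous c (J i) L (\<phi> \<circ> iota_comp \<iota> b) (\<psi> \<circ> iota_comp \<iota> b)"
  then show "\<exists>k'. enat k = enat k' \<and> (\<exists>J. (\<forall>i\<le>k'. subcomplex (J i) (Sd_iter b K)) \<and>
      (\<Union>i\<le>k'. J i) = Sd_iter b K \<and>
      (\<forall>i\<le>k'. c_contiguous c' (J i) L' (\<phi>' \<circ> iota_comp \<iota> b) (\<psi>' \<circ> iota_comp \<iota> b)))"
    by (intro exI[of _ k] exI[of _ J] conjI refl allI impI assms) simp_all
qed

text \<open>Both sequences are antimonotone, so their stable values are infima. In this form a shift
  in \<open>c\<close> is absorbed by reindexing, with no argument about tails of sequences.\<close>

lemma SimpD_eq_INF:
  assumes "simplicial_complex K" "simplicial_complex L" "identity_approximations K \<iota>"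
  shows "SimpD K L \<iota> \<phi> \<psi> = (INF b. INF c. SimpD_bc K L \<iota> b c \<phi> \<psi>)"
  unfolding SimpD_def stable_value_antimono(2)[OF antimono_SimpD_b[OF assms]]
  unfolding SimpD_b_def stable_value_antimono(2)[OF antimono_SimpD_bc[OF assms(2)]] ..

theorem corollary3p8:
  fixes K :: "'a set set" and L :: "'b set set" and M :: "'c set set"
    and rK :: "'a rel" and rL :: "'b rel" and rM :: "'c rel"
    and \<iota> :: "nat \<Rightarrow> 'a sdv \<Rightarrow> 'a sdv"
    and \<phi> \<psi> :: "'a \<Rightarrow> 'b" and \<alpha> :: "'b \<Rightarrow> 'c"
  assumes "ordered_simplicial_complex K rK"
    and "ordered_simplicial_complex L rL"
    and "ordered_simplicial_complex M rM"
    and "identity_approximations K \<iota>"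
    and "simplicial_map K L \<phi>"
    and "simplicial_map K L \<psi>"
    and "simplicial_map L M \<alpha>"
    and "\<exists>\<beta>. simplicial_map M L \<beta> \<and> same_contiguity_class L L (\<beta> \<circ> \<alpha>) id"
  shows "SimpD K M \<iota> (\<alpha> \<circ> \<phi>) (\<alpha> \<circ> \<psi>) = SimpD K L \<iota> \<phi> \<psi>"
proof -
  obtain \<beta> d where \<beta>: "simplicial_map M L \<beta>" and d: "c_contiguous d L L (\<beta> \<circ> \<alpha>) id"
    using assms(8) unfolding same_contiguity_class_def by blast
  have complexes: "simplicial_complex K" "simplicial_complex L" "simplicial_complex M"
    using assms(1-3) by (simp_all add: ordered_simplicial_complex_def)
  have "SimpD_bc K M \<iota> b c (\<alpha> \<circ> \<phi>) (\<alpha> \<circ> \<psi>) \<le> SimpD_bc K L \<iota> b c \<phi> \<psi>" for b c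
    by (rule SimpD_bc_mono) (simp add: comp_assoc c_contiguous_postcomp[OF _ assms(7)])
  moreover have "SimpD_bc K L \<iota> b (d + c + d) \<phi> \<psi> \<le> SimpD_bc K M \<iota> b c (\<alpha> \<circ> \<phi>) (\<alpha> \<circ> \<psi>)" for b c
  proof (rule SimpD_bc_mono)
    fix J
    assume J: "subcomplex J (Sd_iter b K)"
      and "c_contiguous c J M (\<alpha> \<circ> \<phi> \<circ> iota_comp \<iota> b) (\<alpha> \<circ> \<psi> \<circ> iota_comp \<iota> b)"
    \<comment> \<open>Restricting \<open>iota_comp \<iota> b\<close> to \<open>J\<close> makes its
      composites with \<phi> and \<psi> simplicial on \<open>J\<close>, as cancelling \<alpha>
      requires.\<close>
    moreover have "simplicial_map J K (iota_comp \<iota> b)"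
      using simplicial_map_iota_comp[OF assms(4), of b] J
      by (auto simp: simplicial_map_def subcomplex_def)
    ultimately show "c_contiguous (d + c + d) J L (\<phi> \<circ> iota_comp \<iota> b) (\<psi> \<circ> iota_comp \<iota> b)"
      by (intro c_contiguous_cancel_left_inverse[OF _ d \<beta>] simplicial_map_comp[OF _ assms(5)]
          simplicial_map_comp[OF _ assms(6)]) (simp_all only: comp_assoc)
  qed
  ultimately show ?thesis
    unfolding SimpD_eq_INF[OF complexes(1,2) assms(4)] SimpD_eq_INF[OF complexes(1,3) assms(4)]
    \<comment> \<open>The subdivision level \<open>b\<close> is kept fixed. An index
      \<open>c\<close> on the larger side is matched by \<open>c\<close> itself in one direction and
      by \<open>d + c + d\<close> in the other.\<close>
    by - (rule antisym; rule INF_mono'; rule INF_mono; blast)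
qed

end
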